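(* Let $n\ge1$ and let $f:[0,1]\to\mathbb{R}$ be any function. Let $L_n[f]$ denote the unique polynomial of degree at most $n$ that interpolates $f$ at the $n+1$ points $\{i/n:0\le i\le n\}$. Define $e_1(p)=f(p)-\mathbb{E}_p[f(\hat p_n)]$ and, for $m\ge2$, $e_m(p)=e_{m-1}(p)-\mathbb{E}_p[e_{m-1}(\hat p_n)]$, where $n\hat p_n\sim\mathrm{Binomial}(n,p)$. Then $$\lim_{m\to\infty}\ \sup_{p\in[0,1]}\big|e_m(p)-(f(p)-L_n[f](p))\big|=0.$$
   Context: $e_m$ is the bias of the bootstrap bias corrected estimator of $f(p)$ after $m-1$ rounds of correction. Here $\mathbb{E}_p[g(\hat p_n)]=\sum_{i=0}^ng(i/n)\binom nip^i(1-p)^{n-i}$. *)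

theory Defs
  imports "HOL-Library.Extended_Real" "HOL-Computational_Algebra.Polynomial"
begin

text \<open>The expectation of \<open>g (X / n)\<close> for \<open>X\<close> binomially distributed with parameters \<open>n\<close> and \<open>p\<close>.\<close>

definition binom_expect :: "nat \<Rightarrow> (real \<Rightarrow> real) \<Rightarrow> real \<Rightarrow> real" where
  "binom_expect n g p =
     (\<Sum>i=0..n. g (real i / real n) * real (n choose i) * p ^ i * (1 - p) ^ (n - i))"

text \<open>The sequence starts at index 1 in the source; setting the value at index 0 to \<open>f\<close> makes the
  defining equation at index 1 an instance of the recursion.\<close>

primrec boot_bias :: "nat \<Rightarrow> (real \<Rightarrow> real) \<Rightarrow> nat \<Rightarrow> real \<Rightarrow> real" where
  "boot_bias n f 0 = f"
| "boot_bias n f (Suc m) = (\<lambda>p. boot_bias n f m p - binom_expect n (boot_bias n f m) p)"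

lemma boot_bias_1: "boot_bias n f 1 p = f p - binom_expect n f p"
  by simp

lemma boot_bias_rec:
  assumes "m \<ge> 2"
  shows "boot_bias n f m p = boot_bias n f (m - 1) p - binom_expect n (boot_bias n f (m - 1)) p"
  using assms by (cases m) auto

definition interpolates :: "nat \<Rightarrow> (real \<Rightarrow> real) \<Rightarrow> real poly \<Rightarrow> bool" where
  "interpolates n f P \<longleftrightarrow>
     degree P \<le> n \<and> (\<forall>i\<le>n. poly P (real i / real n) = f (real i / real n))"

definition interp_poly :: "nat \<Rightarrow> (real \<Rightarrow> real) \<Rightarrow> real poly" where
  "interp_poly n f = (THE P. interpolates n f P)"

lemma ex1_interpolates:
  assumes "n \<ge> 1"
  shows "\<exists>!P. interpolates n f P"
proof -
  define x where "x i = real i / real n" for i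
  have x_eq: "x i = x j \<longleftrightarrow> i = j" for i j
    using assms by (simp add: x_def)
  define B where "B i = (\<Prod>j\<in>{..n} - {i}. [:- x j, 1:])" for i
  define P where "P = (\<Sum>i\<le>n. smult (f (x i) / poly (B i) (x i)) (B i))"
  have deg_B: "degree (B i) \<le> n" if "i \<le> n" for i
  proof -
    have "degree (B i) \<le> (\<Sum>j\<in>{..n} - {i}. degree [:- x j, 1:])"
      using degree_prod_sum_le[of "{..n} - {i}" "\<lambda>j. [:- x j, 1:]"] by (simp add: B_def o_def)
    also have "\<dots> = n" using that by simp
    finally show ?thesis .
  qed
  have B_nz: "poly (B i) (x i) \<noteq> 0" for i
    by (auto simp: B_def poly_prod x_eq)
  have B_z: "poly (B i) (x k) = 0" if "k \<le> n" "k \<noteq> i" for i k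
    using that by (auto simp: B_def poly_prod)
  have "degree P \<le> n"
    unfolding P_def
    by (intro degree_sum_le) (auto intro: order_trans[OF degree_smult_le] deg_B)
  moreover have "poly P (x k) = f (x k)" if "k \<le> n" for k
  proof -
    have "poly P (x k) = (\<Sum>i\<le>n. if i = k then f (x k) else 0)"
      unfolding P_def poly_sum using that by (intro sum.cong) (auto simp: B_z B_nz)
    then show ?thesis using that by simp
  qed
  ultimately have ex: "interpolates n f P"
    by (simp add: interpolates_def x_def)
  have "Q = P" if Q: "interpolates n f Q" for Q
  proof (rule ccontr)
    assume "Q \<noteq> P"
    then have nz: "Q - P \<noteq> 0" by simp
    have "x ` {..n} \<subseteq> {z. poly (Q - P) z = 0}"
      using Q ex by (auto simp: interpolates_def x_def)
    then have "card (x ` {..n}) \<le> card {z. poly (Q - P) z = 0}"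
      by (intro card_mono poly_roots_finite nz)
    also have "\<dots> \<le> degree (Q - P)" by (rule card_poly_roots_bound[OF nz])
    also have "\<dots> \<le> n"
      using Q ex by (intro degree_diff_le) (auto simp: interpolates_def)
    finally show False
      by (simp add: card_image inj_on_def x_eq)
  qed
  with ex show ?thesis by blast
qed

lemma interpolates_interp_poly: "n \<ge> 1 \<Longrightarrow> interpolates n f (interp_poly n f)"
  unfolding interp_poly_def by (rule theI') (rule ex1_interpolates)

end

theory Submission
  imports Defs
begin

text \<open>
  Write \<open>B\<close> for the operator \<open>binom_expect n\<close>, so that \<open>boot_bias n f m = (I - B)^m f\<close>. As \<open>B g\<close> only
  depends on the values of \<open>g\<close> at the nodes \<open>i/n\<close>, the function \<open>f - L\<close>, with \<open>L\<close> the interpolating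
  polynomial, is annihilated by \<open>B\<close>, and \<open>(I - B)^m f = f - L + (I - B)^m L\<close>. On polynomials of
  degree at most \<open>n\<close> the operator \<open>B\<close> is triangular: it maps the monic polynomial with roots
  \<open>0, 1/n, \<dots>, (k-1)/n\<close> to \<open>\<lambda>\<^sub>k x^k\<close>, where \<open>\<lambda>\<^sub>k = (\<Prod>j<k. 1 - j/n)\<close>. Since \<open>0 < \<lambda>\<^sub>k \<le> 1\<close> for
  \<open>k \<le> n\<close>, all eigenvalues of \<open>I - B\<close> lie in \<open>[0,1)\<close> and \<open>(I - B)^m L\<close> decays geometrically.
\<close>

section \<open>Factorial moments of the binomial distribution\<close>

definition node_poly :: "nat \<Rightarrow> nat \<Rightarrow> real poly" where
  "node_poly n k = (\<Prod>j<k. [:- (real j / real n), 1:])"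

definition binom_eigenvalue :: "nat \<Rightarrow> nat \<Rightarrow> real" where
  "binom_eigenvalue n k = (\<Prod>j<k. 1 - real j / real n)"

lemma degree_node_poly: "degree (node_poly n k) = k"
  unfolding node_poly_def by (subst degree_prod_eq_sum_degree) auto

lemma coeff_node_poly_top: "coeff (node_poly n k) k = 1"
  using lead_coeff_prod[of "\<lambda>j. [:- (real j / real n), 1:]" "{..<k}"]
    degree_node_poly[of n k] by (simp add: node_poly_def)

text \<open>At a node the product is a scaled falling factorial of \<open>i\<close>, and binomial
  means of falling factorials have a closed form.\<close>

lemma poly_node_poly_at_node:
  assumes "n \<ge> 1"
  shows "poly (node_poly n k) (real i / real n) = fact k * real (i choose k) / real n ^ k"
proof -
  have "poly (node_poly n k) (real i / real n) = (\<Prod>j<k. (real i - real j) / real n)"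
    by (simp add: node_poly_def poly_prod diff_divide_distrib)
  also have "\<dots> = (\<Prod>j=0..<k. real i - real j) / real n ^ k"
    by (simp add: prod_dividef lessThan_atLeast0)
  also have "(\<Prod>j=0..<k. real i - real j) = fact k * (real i gchoose k)"
    by (simp add: gbinomial_mult_fact)
  finally show ?thesis
    by (simp add: binomial_gbinomial)
qed

lemma binom_eigenvalue_eq:
  assumes "n \<ge> 1"
  shows "binom_eigenvalue n k = fact k * real (n choose k) / real n ^ k"
  \<comment> \<open>The eigenvalue is the value of \<open>node_poly n k\<close> at 1, the node with
    index \<open>n\<close>.\<close>
  using poly_node_poly_at_node[OF assms, of k n] assms
  by (simp add: binom_eigenvalue_def node_poly_def poly_prod)

lemma binom_eigenvalue_pos: "k \<le> n \<Longrightarrow> binom_eigenvalue n k > 0"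
  unfolding binom_eigenvalue_def by (intro prod_pos) auto

lemma binom_eigenvalue_le_1: "k \<le> n \<Longrightarrow> binom_eigenvalue n k \<le> 1"
  unfolding binom_eigenvalue_def by (intro prod_le_1) auto

lemma binom_expect_node_poly:
  assumes "n \<ge> 1" "k \<le> n"
  shows "binom_expect n (poly (node_poly n k)) p = binom_eigenvalue n k * p ^ k"
proof -
  define F where "F i = fact k * real (i choose k) / real n ^ k * real (n choose i) *
    p ^ i * (1 - p) ^ (n - i)" for i
  have "binom_expect n (poly (node_poly n k)) p = (\<Sum>i=0..n. F i)"
    by (simp add: binom_expect_def F_def poly_node_poly_at_node[OF assms(1)])
  also have "\<dots> = (\<Sum>i=k..n. F i)"
    by (rule sum.mono_neutral_right) (auto simp: F_def)
  also have "\<dots> = (\<Sum>i=0..n - k. F (i + k))"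
    using assms(2) sum.shift_bounds_cl_nat_ivl[of F 0 k "n - k"] by simp
  also have "\<dots> = (\<Sum>i=0..n - k. binom_eigenvalue n k * p ^ k *
      (real ((n - k) choose i) * p ^ i * (1 - p) ^ (n - k - i)))"
  proof (rule sum.cong)
    fix i assume i: "i \<in> {0..n - k}"
    \<comment> \<open>Trinomial revision turns the sum into a binomial expansion of exponent
      \<open>n - k\<close>.\<close>
    have "(n choose (i + k)) * ((i + k) choose k) = (n choose k) * ((n - k) choose i)"
      using choose_mult[of k "i + k" n] i assms(2) by auto
    then have "real (n choose (i + k)) * real ((i + k) choose k)
        = real (n choose k) * real ((n - k) choose i)"
      by (metis of_nat_mult)
    then show "F (i + k) = binom_eigenvalue n k * p ^ k *
        (real ((n - k) choose i) * p ^ i * (1 - p) ^ (n - k - i))"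
      by (simp add: F_def binom_eigenvalue_eq[OF assms(1)] power_add add.commute)
        (metis (no_types, lifting) mult.assoc mult.commute)
  qed simp
  also have "\<dots> = binom_eigenvalue n k * p ^ k * (p + (1 - p)) ^ (n - k)"
    by (simp only: binomial_ring sum_distrib_left atLeast0AtMost)
  finally show ?thesis by simp
qed

section \<open>Linearity and dependence on node values\<close>

lemma binom_expect_add:
  "binom_expect n (\<lambda>x. f x + g x) p = binom_expect n f p + binom_expect n g p"
  by (simp add: binom_expect_def sum.distrib algebra_simps)

lemma binom_expect_cmult: "binom_expect n (\<lambda>x. c * f x) p = c * binom_expect n f p"
  by (simp add: binom_expect_def sum_distrib_left algebra_simps)

lemma binom_expect_cong:
  assumes "\<And>i. i \<le> n \<Longrightarrow> f (real i / real n) = g (real i / real n)"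
  shows "binom_expect n f p = binom_expect n g p"
  unfolding binom_expect_def using assms by (intro sum.cong) auto

lemma boot_bias_linear:
  "boot_bias n (\<lambda>x. c * f x + g x) m p = c * boot_bias n f m p + boot_bias n g m p"
proof (induction m arbitrary: p)
  case (Suc m)
  have "boot_bias n (\<lambda>x. c * f x + g x) m
      = (\<lambda>p. c * boot_bias n f m p + boot_bias n g m p)"
    using Suc.IH by blast
  then show ?case
    by (simp add: binom_expect_add binom_expect_cmult algebra_simps)
qed simp

text \<open>The recursion applies I - B on the outside; moving one application inside lets linearity
  act on (I - B) P.\<close>

lemma boot_bias_Suc_shift:
  "boot_bias n f (Suc m) = boot_bias n (\<lambda>p. f p - binom_expect n f p) m"
  by (induction m) simp_all

lemma boot_bias_eq_add:
  assumes "\<And>i. i \<le> n \<Longrightarrow> f (real i / real n) = g (real i / real n)"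
  shows "boot_bias n f m p = f p - g p + boot_bias n g m p"
proof (induction m arbitrary: p)
  case (Suc m)
  \<comment> \<open>The difference of the iterates is \<open>f - g\<close>, which vanishes at the
    nodes.\<close>
  have "binom_expect n (boot_bias n f m) p = binom_expect n (boot_bias n g m) p"
    by (rule binom_expect_cong) (simp add: Suc.IH assms)
  then show ?case
    by (simp add: Suc.IH)
qed simp

section \<open>Triangular action on polynomials\<close>

text \<open>The condition \<open>\<forall>i\<ge>k. coeff P i = 0\<close> says \<open>degree P < k\<close>, with the zero polynomial as the
  only instance for \<open>k = 0\<close>.\<close>

lemma binom_expect_poly_triangular_step:
  assumes "n \<ge> 1" "k \<le> n" and P: "\<forall>i\<ge>Suc k. coeff P i = 0"
    and lower: "\<And>Q. \<forall>i\<ge>k. coeff Q i = 0 \<Longrightarrow>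
      \<exists>S. (\<forall>i\<ge>k. coeff S i = 0) \<and> (\<forall>p. binom_expect n (poly Q) p = poly S p)"
  shows "\<exists>R. (\<forall>i\<ge>k. coeff R i = 0) \<and>
    (\<forall>p. binom_expect n (poly P) p = binom_eigenvalue n k * poly P p + poly R p)"
proof -
  define a where "a = coeff P k"
  define Q where "Q = P - smult a (node_poly n k)"
  have Q0: "coeff Q i = 0" if "i \<ge> k" for i
    using that P coeff_eq_0[of "node_poly n k" i]
    by (cases "i = k") (auto simp: Q_def a_def coeff_node_poly_top degree_node_poly)
  then obtain S where S: "\<forall>i\<ge>k. coeff S i = 0" "\<And>p. binom_expect n (poly Q) p = poly S p"
    using lower[of Q] by blast
  \<comment> \<open>B P is \<lambda> a x^k + S with \<lambda> the eigenvalue; subtracting \<lambda>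
    P cancels the coefficient of x^k.\<close>
  define R where "R = smult (binom_eigenvalue n k) (monom a k - P) + S"
  have "coeff R i = 0" if "i \<ge> k" for i
    using that P S(1) by (cases "i = k") (auto simp: R_def a_def)
  moreover have "binom_expect n (poly P) p = binom_eigenvalue n k * poly P p + poly R p" for p
  proof -
    have "poly P = (\<lambda>x. a * poly (node_poly n k) x + poly Q x)"
      by (auto simp: Q_def)
    then have "binom_expect n (poly P) p = a * (binom_eigenvalue n k * p ^ k) + poly S p"
      by (simp add: binom_expect_add binom_expect_cmult S(2)
          binom_expect_node_poly[OF assms(1,2)])
    then show ?thesis
      by (simp add: R_def poly_monom algebra_simps)
  qed
  ultimately show ?thesis by blast
qed

text \<open>Invariance and triangular form alternate: invariance below degree \<open>k\<close>
  yields the form at degree \<open>k\<close>, which yields invariance one degree up.\<close>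

lemma binom_expect_poly_eq_poly:
  assumes "n \<ge> 1" "k \<le> Suc n" "\<forall>i\<ge>k. coeff P i = 0"
  shows "\<exists>S. (\<forall>i\<ge>k. coeff S i = 0) \<and> (\<forall>p. binom_expect n (poly P) p = poly S p)"
  using assms(2,3)
proof (induction k arbitrary: P)
  case 0
  then have "P = 0" by (auto intro: poly_eqI)
  then show ?case by (intro exI[of _ 0]) (simp add: binom_expect_def)
next
  case (Suc k)
  then obtain R where R: "\<forall>i\<ge>k. coeff R i = 0"
      "\<forall>p. binom_expect n (poly P) p = binom_eigenvalue n k * poly P p + poly R p"
    using binom_expect_poly_triangular_step[OF assms(1), of k P] by auto
  then show ?case
    using Suc.prems by (intro exI[of _ "smult (binom_eigenvalue n k) P + R"]) auto
qed

lemma binom_expect_poly_triangular: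
  assumes "n \<ge> 1" "k \<le> n" "\<forall>i\<ge>Suc k. coeff P i = 0"
  shows "\<exists>R. (\<forall>i\<ge>k. coeff R i = 0) \<and>
    (\<forall>p. binom_expect n (poly P) p = binom_eigenvalue n k * poly P p + poly R p)"
  using assms by (intro binom_expect_poly_triangular_step binom_expect_poly_eq_poly) auto

section \<open>Geometric decay of the iterates\<close>

lemma poly_bounded_unit_interval:
  fixes P :: "real poly"
  shows "\<exists>A\<ge>0. \<forall>p\<in>{0..1}. \<bar>poly P p\<bar> \<le> A"
proof (intro exI conjI ballI)
  fix p :: real assume p: "p \<in> {0..1}"
  have "\<bar>poly P p\<bar> \<le> (\<Sum>i\<le>degree P. \<bar>coeff P i * p ^ i\<bar>)"
    unfolding poly_altdef by (rule sum_abs)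
  also have "\<dots> \<le> (\<Sum>i\<le>degree P. \<bar>coeff P i\<bar>)"
    using p by (intro sum_mono) (auto simp: abs_mult power_le_one intro!: mult_left_le)
  finally show "\<bar>poly P p\<bar> \<le> (\<Sum>i\<le>degree P. \<bar>coeff P i\<bar>)" .
qed (simp add: sum_nonneg)

text \<open>The constant K = A + C / (t - c) satisfies K \<ge> A and c K + C \<le> t K, as the
  induction needs. The gap between c and t absorbs the resonance c = s, where growth like m s^m can
  occur.\<close>

lemma perturbed_contraction_geometric_bound:
  fixes a r :: "nat \<Rightarrow> real"
  assumes rec: "\<And>m. a (Suc m) = c * a m + r m" and r: "\<And>m. \<bar>r m\<bar> \<le> C * s ^ m"
    and "\<bar>a 0\<bar> \<le> A" "0 \<le> c" "c < t" "0 \<le> s" "s \<le> t" "0 \<le> C"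
  shows "\<bar>a m\<bar> \<le> (A + C / (t - c)) * t ^ m"
proof (induction m)
  case 0
  then show ?case using assms by (simp add: add_increasing2)
next
  case (Suc m)
  let ?K = "A + C / (t - c)"
  have "\<bar>a (Suc m)\<bar> \<le> c * \<bar>a m\<bar> + \<bar>r m\<bar>"
    using rec[of m] \<open>0 \<le> c\<close> abs_triangle_ineq[of "c * a m" "r m"] by (simp add: abs_mult)
  also have "\<dots> \<le> c * (?K * t ^ m) + C * t ^ m"
  proof (intro add_mono mult_left_mono Suc.IH)
    show "\<bar>r m\<bar> \<le> C * t ^ m"
      using assms by (intro order_trans[OF r] mult_left_mono power_mono) auto
  qed fact
  also have "\<dots> = (c * ?K + C) * t ^ m"
    by (simp add: algebra_simps)
  also have "\<dots> \<le> (t * ?K) * t ^ m"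
  proof (intro mult_right_mono)
    have "(t - c) * (C / (t - c)) = C" "0 \<le> (t - c) * A"
      using assms by auto
    then have "C \<le> (t - c) * ?K"
      by (simp add: distrib_left)
    then show "c * ?K + C \<le> t * ?K"
      by (simp add: left_diff_distrib)
  qed (use assms in auto)
  finally show ?case by (simp add: mult_ac)
qed

text \<open>As (I - B) P = c P - R with R of lower degree, the iterates of P at a fixed p obey a
  scalar recursion forced by those of -R, which decay by induction at a rate independent of
  p.\<close>

lemma boot_bias_poly_geometric_bound:
  assumes "n \<ge> 1" "k \<le> Suc n" "\<forall>i\<ge>k. coeff P i = 0"
  shows "\<exists>C t. 0 \<le> C \<and> 0 \<le> t \<and> t < 1 \<and>
    (\<forall>m. \<forall>p\<in>{0..1}. \<bar>boot_bias n (poly P) m p\<bar> \<le> C * t ^ m)"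
  using assms(2,3)
proof (induction k arbitrary: P)
  case 0
  then have "P = 0" by (auto intro: poly_eqI)
  \<comment> \<open>Linearity with factor 1 makes this value equal to twice itself.\<close>
  have "boot_bias n (\<lambda>x. 0) m p = 0" for m p
    using boot_bias_linear[of n 1 "\<lambda>x. 0" "\<lambda>x. 0" m p] by simp
  with \<open>P = 0\<close> show ?case by (intro exI[of _ 0]) (simp add: poly_0[abs_def])
next
  case (Suc k)
  then have k: "k \<le> n" by simp
  obtain R where R: "\<forall>i\<ge>k. coeff R i = 0"
      "\<And>p. binom_expect n (poly P) p = binom_eigenvalue n k * poly P p + poly R p"
    using binom_expect_poly_triangular[OF assms(1) k Suc.prems(2)] by blast
  have "\<forall>i\<ge>k. coeff (- R) i = 0" using R(1) by simp
  then obtain C s where C: "0 \<le> C" "0 \<le> s" "s < 1"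
      "\<And>m p. p \<in> {0..1} \<Longrightarrow> \<bar>boot_bias n (poly (- R)) m p\<bar> \<le> C * s ^ m"
    using Suc.IH[of "- R"] k by fastforce
  obtain A where A: "A \<ge> 0" "\<And>p. p \<in> {0..1} \<Longrightarrow> \<bar>poly P p\<bar> \<le> A"
    using poly_bounded_unit_interval by blast
  define c where "c = 1 - binom_eigenvalue n k"
  have c: "0 \<le> c" "c < 1"
    using binom_eigenvalue_pos[OF k] binom_eigenvalue_le_1[OF k] by (auto simp: c_def)
  obtain t where t: "max c s < t" "t < 1"
    using dense[of "max c s" 1] c C by auto
  have rec: "boot_bias n (poly P) (Suc m) p
      = c * boot_bias n (poly P) m p + boot_bias n (poly (- R)) m p" for m p
  proof -
    have "(\<lambda>p. poly P p - binom_expect n (poly P) p) = (\<lambda>p. c * poly P p + poly (- R) p)"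
      by (simp add: R(2) c_def algebra_simps)
    then show ?thesis
      by (simp only: boot_bias_Suc_shift boot_bias_linear)
  qed
  have "\<bar>boot_bias n (poly P) m p\<bar> \<le> (A + C / (t - c)) * t ^ m" if "p \<in> {0..1}" for m p
    using that t c C A
    by (intro perturbed_contraction_geometric_bound[where r = "\<lambda>m. boot_bias n (poly (- R)) m p"
          and s = s] rec) auto
  moreover have "0 \<le> A + C / (t - c)" "0 \<le> t"
    using t c C A by auto
  ultimately show ?case using t(2) by blast
qed

theorem theorem7:
  fixes n :: nat and f :: "real \<Rightarrow> real"
  assumes "n \<ge> 1"
  shows "(\<lambda>m. SUP p\<in>{0..1}. ereal \<bar>boot_bias n f m p - (f p - poly (interp_poly n f) p)\<bar>)
           \<longlonglongrightarrow> 0"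
proof -
  define L where "L = interp_poly n f"
  have L: "degree L \<le> n" "\<And>i. i \<le> n \<Longrightarrow> f (real i / real n) = poly L (real i / real n)"
    using interpolates_interp_poly[OF assms, of f] by (auto simp: L_def interpolates_def)
  \<comment> \<open>Degree at most \<open>n\<close> is the case \<open>k = Suc n\<close> of the
    decay bound.\<close>
  have "\<forall>i\<ge>Suc n. coeff L i = 0"
    using L(1) by (auto intro: coeff_eq_0)
  then obtain C t where C: "0 \<le> t" "t < 1"
      "\<And>m p. p \<in> {0..1} \<Longrightarrow> \<bar>boot_bias n (poly L) m p\<bar> \<le> C * t ^ m"
    using boot_bias_poly_geometric_bound[OF assms order_refl] by blast
  have eq: "boot_bias n f m p - (f p - poly L p) = boot_bias n (poly L) m p" for m p
    using boot_bias_eq_add[of n f "poly L" m p] L(2) by simp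
  have "(\<lambda>m. C * t ^ m) \<longlonglongrightarrow> 0"
    using C(1,2) by (intro tendsto_mult_right_zero LIMSEQ_power_zero) auto
  then have lim: "(\<lambda>m. ereal (C * t ^ m)) \<longlonglongrightarrow> 0"
    by (simp add: zero_ereal_def)
  show ?thesis
    unfolding L_def[symmetric] eq
  proof (rule tendsto_sandwich[OF _ _ tendsto_const lim])
    \<comment> \<open>The witness p = 0 is needed because an empty supremum would be
      -\<infinity>.\<close>
    show "\<forall>\<^sub>F m in sequentially. 0 \<le> (SUP p\<in>{0..1}. ereal \<bar>boot_bias n (poly L) m p\<bar>)"
      by (intro always_eventually allI SUP_upper2[of 0]) auto
    show "\<forall>\<^sub>F m in sequentially.
        (SUP p\<in>{0..1}. ereal \<bar>boot_bias n (poly L) m p\<bar>) \<le> ereal (C * t ^ m)"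
      using C(3) by (intro always_eventually allI SUP_least) auto
  qed
qed

end
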